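(* Let $q\ge1$, $\gamma>0$. Let $\{\kappa_l\}_{l=1}^\infty$ and $\{m_k\}_{k=1}^\infty$ be real sequences such that $\kappa_l=0$ for all odd $l$, $m_k=0$ for all odd $k$, and $\{m_{2k}\}_{k=1}^\infty=\mathrm{T}^{q,\gamma}_{\kappa\to m}(\{\kappa_l\}_{l=1}^\infty)$. Then for every $k=1,2,\dots$, $$m_{2k}=\sum_{\pi\in\mathfrak{NC}(2k)}W(\pi)\prod_{B_i\in\pi}\kappa_{|B_i|}.$$
   Context: The map $\mathrm{T}^{q,\gamma}_{\kappa\to m}$. On formal power series $\mathbb{R}[[z]]$ define linear operators: $\partial(z^n)=nz^{n-1}$; $d(z^n)=z^{n-1}$ for $n\ge1$, $d(1)=0$; $d'(z^n)=2z^{n-1}$ for $n$ odd and $0$ for $n$ even; $*_g$ is multiplication by $g(z)$; $[z^0]$ takes the constant term. Then $\mathrm{T}^{q,\gamma}_{\kappa\to m}(\{\kappa_l\}_{l\ge1})=\{m_{2k}\}_{k\ge1}$ where $$m_{2k}=[z^0]\bigl(\partial+2\gamma d+((q-1)\gamma-\tfrac12)d'+*_g\bigr)^{2k-1}g(z),\qquad g(z)=\sum_{l=1}^\infty\kappa_lz^{l-1}.$$ Combinatorial notation. $\mathfrak{NC}(2k)$ is the set of non-crossing set partitions $\pi=B_1\sqcup\dots\sqcup B_s$ of $\{1,\dots,2k\}$ all of whose blocks have even size; blocks are labeled in increasing order of $\min(B_i)$. $P_i$ is the number of elements of $B_1\cup\dots\cup B_i$ bigger than $\min(B_i)$; $Q_i$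 is the number of elements of $B_1\cup\dots\cup B_i$ bigger than $\max(B_i)$. $C_1,C_2,\dots$ is the sequence $2q\gamma,\,2\gamma+2,\,2q\gamma+2,\,2\gamma+4,\,2q\gamma+4,\,2\gamma+6,\,2q\gamma+6,\dots$. The weight is $W(\pi)=\prod_{i=1}^s[C_{Q_i+1}C_{Q_i+2}\cdots C_{P_i}]$. *)

theory Defs
  imports Complex_Main "HOL-Computational_Algebra.Formal_Power_Series" "HOL-Library.Disjoint_Sets"
begin

(* The operators d and d' are given on the monomials z^n and extended linearly, coefficient
   by coefficient, to formal power series; the operator called "partial" is fps_deriv. *)

definition op_d :: "real fps \<Rightarrow> real fps" where
  "op_d f = Abs_fps (\<lambda>n. fps_nth f (n + 1))"

definition op_d' :: "real fps \<Rightarrow> real fps" where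
  "op_d' f = Abs_fps (\<lambda>n. if odd (n + 1) then 2 * fps_nth f (n + 1) else 0)"

lemma op_d_monomial:
  "op_d (fps_X ^ n) = (if n = 0 then 0 else fps_X ^ (n - 1))"
  by (rule fps_ext) (cases n; auto simp: op_d_def)

lemma op_d'_monomial:
  "op_d' (fps_X ^ n) = (if odd n then fps_const 2 * fps_X ^ (n - 1) else 0)"
  by (rule fps_ext) (cases n; auto simp: op_d'_def)

(* Sequences indexed by l = 1, 2, ... are functions on nat whose value at 0 is never used. *)

definition gen_series :: "(nat \<Rightarrow> real) \<Rightarrow> real fps" where
  "gen_series \<kappa> = Abs_fps (\<lambda>n. \<kappa> (n + 1))"

definition T_op :: "real \<Rightarrow> real \<Rightarrow> real fps \<Rightarrow> real fps \<Rightarrow> real fps" where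
  "T_op q \<gamma> g f = fps_deriv f + fps_const (2 * \<gamma>) * op_d f
     + fps_const ((q - 1) * \<gamma> - 1 / 2) * op_d' f + g * f"

(* The k-th entry (k \<ge> 1) of T_kappa_m q \<gamma> \<kappa> is m_{2k}. *)

definition T_kappa_m :: "real \<Rightarrow> real \<Rightarrow> (nat \<Rightarrow> real) \<Rightarrow> nat \<Rightarrow> real" where
  "T_kappa_m q \<gamma> \<kappa> k =
     fps_nth ((T_op q \<gamma> (gen_series \<kappa>) ^^ (2 * k - 1)) (gen_series \<kappa>)) 0"

definition noncrossing :: "nat set set \<Rightarrow> bool" where
  "noncrossing \<pi> \<longleftrightarrow> \<not> (\<exists>A\<in>\<pi>. \<exists>B\<in>\<pi>. A \<noteq> B \<and>
     (\<exists>a\<in>A. \<exists>b\<in>B. \<exists>c\<in>A. \<exists>d\<in>B. a < b \<and> b < c \<and> c < d))"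

definition NC_even :: "nat \<Rightarrow> nat set set set" where
  "NC_even n = {\<pi>. partition_on {1..n} \<pi> \<and> noncrossing \<pi> \<and> (\<forall>B\<in>\<pi>. even (card B))}"

(* The blocks listed by increasing minimum. List positions start at 0, so the block labeled
   i + 1 is blocks \<pi> ! i, and P_stat \<pi> i, Q_stat \<pi> i are the statistics of that block. *)

definition blocks :: "nat set set \<Rightarrow> nat set list" where
  "blocks \<pi> = sorted_key_list_of_set Min \<pi>"

(* Interpreting folding_insort_key at the order of a linorder type yields the locale-level
   constants; these equations turn them into the class-level ones. *)

lemma linorder_insort_key_eq:
  "linorder.insort_key (\<le>) = (insort_key :: ('b \<Rightarrow> 'a::linorder) \<Rightarrow> _)"
proof (intro ext)
  fix f :: "'b \<Rightarrow> 'a" and x xs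
  show "linorder.insort_key (\<le>) f x xs = insort_key f x xs"
    by (induction xs) (simp_all add: linorder.insort_key.simps[OF linorder_axioms])
qed

lemma linorder_sorted_key_list_of_set_eq:
  fixes f :: "'b \<Rightarrow> 'a::linorder"
  shows "linorder.sorted_key_list_of_set (\<le>) f = sorted_key_list_of_set f"
  by (simp add: linorder.sorted_key_list_of_set_def[OF linorder_axioms]
      sorted_key_list_of_set_def linorder_insort_key_eq)

lemma blocks_NC_even:
  assumes "\<pi> \<in> NC_even n"
  shows "set (blocks \<pi>) = \<pi>" and "sorted_wrt (\<lambda>A B. Min A < Min B) (blocks \<pi>)"
proof -
  have part: "partition_on {1..n} \<pi>"
    using assms by (simp add: NC_even_def)
  have fin: "finite \<pi>"
    using part finite_elements by blast
  have Min_mem: "Min B \<in> B" if "B \<in> \<pi>" for B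
  proof (rule Min_in)
    show "finite B"
      using part that by (metis finite_atLeastAtMost partition_onD1 Sup_upper finite_subset)
    show "B \<noteq> {}"
      using part that partition_onD3 by blast
  qed
  have inj: "inj_on Min \<pi>"
  proof (rule inj_onI)
    fix A B assume "A \<in> \<pi>" "B \<in> \<pi>" "Min A = Min B"
    then show "A = B"
      using Min_mem[of A] Min_mem[of B] partition_onD2[OF part] disjointD by fastforce
  qed
  interpret key: folding_insort_key "(\<le>)" "(<)" \<pi> Min
    by standard (rule inj)
  show "set (blocks \<pi>) = \<pi>"
    using key.set_sorted_key_list_of_set[of \<pi>] fin
    by (simp add: blocks_def linorder_sorted_key_list_of_set_eq)
  show "sorted_wrt (\<lambda>A B. Min A < Min B) (blocks \<pi>)"
    using key.strict_sorted_key_list_of_set[of \<pi>]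
    by (simp add: blocks_def sorted_wrt_map linorder_sorted_key_list_of_set_eq)
qed

definition first_blocks :: "nat set set \<Rightarrow> nat \<Rightarrow> nat set" where
  "first_blocks \<pi> i = (\<Union>j\<le>i. blocks \<pi> ! j)"

definition P_stat :: "nat set set \<Rightarrow> nat \<Rightarrow> nat" where
  "P_stat \<pi> i = card {x \<in> first_blocks \<pi> i. x > Min (blocks \<pi> ! i)}"

definition Q_stat :: "nat set set \<Rightarrow> nat \<Rightarrow> nat" where
  "Q_stat \<pi> i = card {x \<in> first_blocks \<pi> i. x > Max (blocks \<pi> ! i)}"

(* C_1, C_2, C_3, C_4, C_5, ... is
   2 q \<gamma>, 2 \<gamma> + 2, 2 q \<gamma> + 2, 2 \<gamma> + 4, 2 q \<gamma> + 4, ...; the index 0 is never used. *)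

definition C_seq :: "real \<Rightarrow> real \<Rightarrow> nat \<Rightarrow> real" where
  "C_seq q \<gamma> n = (if odd n then 2 * q * \<gamma> + (real n - 1) else 2 * \<gamma> + real n)"

definition W_weight :: "real \<Rightarrow> real \<Rightarrow> nat set set \<Rightarrow> real" where
  "W_weight q \<gamma> \<pi> =
     (\<Prod>i<length (blocks \<pi>). \<Prod>j\<in>{Q_stat \<pi> i + 1..P_stat \<pi> i}. C_seq q \<gamma> j)"

end

theory Submission
  imports Defs
begin

text \<open>The operator sends $z^n$ to $C_n z^{n-1} + g(z) z^n$, so the coefficients of its iterates on $1$
  satisfy $F(n+1,h) = C_{h+1} F(n,h+1) + \sum_i \kappa_{i+1} F(n,h-i)$. Encode a partition by the
  map $r$ sending each element to the minimum of its block. The non-crossing partitions of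
  $\{1,\dots,n+h\}$ with all block minima at most $n$ satisfy the same recursion: if $n+1$
  is not a minimum, it contributes the factor $C_{h+1}$, and if it is one, non-crossing forces its
  block to be an interval $\{n+1,\dots,n+1+i\}$, which can be deleted. Inside the block
  $B_i$, the non-minimal elements contribute exactly $C_{P_i},\dots,C_{Q_i+1}$.\<close>

section \<open>Root maps: partitions recorded by block minima\<close>

text \<open>The last condition is non-crossing: \<open>r x < r y < x < y\<close> would be a crossing
  of two blocks. The \<open>h\<close> points after \<open>n\<close> form a tail that may only join
  blocks begun at or before \<open>n\<close>. The default value 0 off \<open>{1..n + h}\<close>
  makes a partition correspond to exactly one function.\<close>

definition root_maps :: "nat \<Rightarrow> nat \<Rightarrow> (nat \<Rightarrow> nat) set" where
  "root_maps n h = {r.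
     (\<forall>y. 1 \<le> y \<and> y \<le> n + h \<longrightarrow> 1 \<le> r y \<and> r y \<le> y \<and> r y \<le> n \<and> r (r y) = r y) \<and>
     (\<forall>y. y = 0 \<or> n + h < y \<longrightarrow> r y = 0) \<and>
     (\<forall>x y. r y < x \<and> x < y \<and> y \<le> n + h \<longrightarrow> r y \<le> r x)}"

text \<open>Factors are taken over \<open>{1..n}\<close> only, but the cardinalities see the tail as
  well, so a block is charged its full size. A non-root \<open>x\<close> is itself among the counted
  \<open>y\<close>, and \<open>1 \<le> r y\<close> excludes the points carrying the default value
  0.\<close>

definition root_weight :: "(nat \<Rightarrow> real) \<Rightarrow> (nat \<Rightarrow> real) \<Rightarrow> nat \<Rightarrow> (nat \<Rightarrow> nat) \<Rightarrow> real" where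
  "root_weight \<kappa> c n r = (\<Prod>x\<in>{1..n}. if r x = x then \<kappa> (card {y. r y = x})
     else c (card {y. x \<le> y \<and> 1 \<le> r y \<and> r y < x}))"

text \<open>The new block has \<open>i + 1\<close> elements, and the old tail moves right by that
  much. Its values need no shift, since roots are at most \<open>n\<close>.\<close>

definition insert_block :: "nat \<Rightarrow> nat \<Rightarrow> (nat \<Rightarrow> nat) \<Rightarrow> nat \<Rightarrow> nat" where
  "insert_block n i r y =
     (if y \<le> n then r y else if y \<le> n + i + 1 then n + 1 else r (y - (i + 1)))"

definition delete_block :: "nat \<Rightarrow> nat \<Rightarrow> (nat \<Rightarrow> nat) \<Rightarrow> nat \<Rightarrow> nat" where
  "delete_block n i r y = (if y \<le> n then r y else r (y + (i + 1)))"

lemma root_mapsD: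
  assumes "r \<in> root_maps n h"
  shows "1 \<le> y \<Longrightarrow> y \<le> n + h \<Longrightarrow> 1 \<le> r y"
    and "r y \<le> y" and "r y \<le> n" and "r (r y) = r y"
    and "y = 0 \<or> n + h < y \<Longrightarrow> r y = 0"
    and "r y < x \<Longrightarrow> x < y \<Longrightarrow> y \<le> n + h \<Longrightarrow> r y \<le> r x"
proof -
  have *: "\<forall>y. 1 \<le> y \<and> y \<le> n + h \<longrightarrow> 1 \<le> r y \<and> r y \<le> y \<and> r y \<le> n \<and> r (r y) = r y"
    and z: "\<forall>y. y = 0 \<or> n + h < y \<longrightarrow> r y = 0"
    and nc: "\<forall>x y. r y < x \<and> x < y \<and> y \<le> n + h \<longrightarrow> r y \<le> r x"
    using assms by (auto simp: root_maps_def)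
  show "1 \<le> y \<Longrightarrow> y \<le> n + h \<Longrightarrow> 1 \<le> r y" using * by blast
  show "r y \<le> y" "r y \<le> n" "r (r y) = r y"
    using *[rule_format, of y] z[rule_format, of y] z[rule_format, of 0]
    by (cases "1 \<le> y \<and> y \<le> n + h"; force)+
  show "y = 0 \<or> n + h < y \<Longrightarrow> r y = 0" by (rule z[rule_format])
  show "r y < x \<Longrightarrow> x < y \<Longrightarrow> y \<le> n + h \<Longrightarrow> r y \<le> r x" using nc by simp
qed

lemma root_mapsI:
  assumes "\<And>y. 1 \<le> y \<Longrightarrow> y \<le> n + h \<Longrightarrow> 1 \<le> r y \<and> r y \<le> y \<and> r y \<le> n \<and> r (r y) = r y"
    and "\<And>y. y = 0 \<or> n + h < y \<Longrightarrow> r y = 0"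
    and "\<And>x y. r y < x \<Longrightarrow> x < y \<Longrightarrow> y \<le> n + h \<Longrightarrow> r y \<le> r x"
  shows "r \<in> root_maps n h"
proof -
  have "\<forall>y. 1 \<le> y \<and> y \<le> n + h \<longrightarrow> 1 \<le> r y \<and> r y \<le> y \<and> r y \<le> n \<and> r (r y) = r y"
    using assms(1) by blast
  moreover have "\<forall>y. y = 0 \<or> n + h < y \<longrightarrow> r y = 0"
    using assms(2) by blast
  moreover have "\<forall>x y. r y < x \<and> x < y \<and> y \<le> n + h \<longrightarrow> r y \<le> r x"
    by (intro allI impI) (elim conjE, rule assms(3))
  ultimately show ?thesis unfolding root_maps_def by simp
qed

lemma finite_root_maps [simp]: "finite (root_maps n h)"
proof (rule finite_subset)
  show "root_maps n h \<subseteq> {f. \<forall>x. (x \<in> {1..n + h} \<longrightarrow> f x \<in> {0..n}) \<and> (x \<notin> {1..n + h} \<longrightarrow> f x = 0)}"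
    by (auto dest: root_mapsD simp: not_le)
  show "finite {f. \<forall>x. (x \<in> {1..n + h} \<longrightarrow> f x \<in> {0..n}) \<and> (x \<notin> {1..n + h} \<longrightarrow> f x = 0)}"
    by (rule finite_set_of_finite_funs) auto
qed

text \<open>A tail cannot exist without a block to join. This matches the coefficients of the
  constant series 1.\<close>

lemma root_maps_0_left: "root_maps 0 h = (if h = 0 then {\<lambda>_. 0} else {})"
proof (cases "h = 0")
  case True
  then show ?thesis by (auto simp: root_maps_def)
next
  case False
  have "r \<notin> root_maps 0 h" for r
    using root_mapsD(1)[of r 0 h 1] root_mapsD(3)[of r 0 h 1] False by fastforce
  then show ?thesis using False by auto
qed

section \<open>The recursion for weighted sums over root maps\<close>

text \<open>Every value of \<open>r\<close> is a fixed point. Hence if \<open>Suc n\<close> is not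
  fixed, it is not a value at all and simply becomes the first point of the tail.\<close>

lemma root_maps_Suc_not_root:
  "{r \<in> root_maps (Suc n) h. r (Suc n) \<noteq> Suc n} = root_maps n (Suc h)"
proof (intro subset_antisym subsetI)
  fix r assume "r \<in> {r \<in> root_maps (Suc n) h. r (Suc n) \<noteq> Suc n}"
  then have r: "r \<in> root_maps (Suc n) h" and ne: "r (Suc n) \<noteq> Suc n" by auto
  note D = root_mapsD[OF r]
  have "r y \<le> n" for y
    using D(3)[of y] D(4)[of y] ne by (metis le_Suc_eq)
  then show "r \<in> root_maps n (Suc h)"
    using D by (intro root_mapsI) auto
next
  fix r assume r: "r \<in> root_maps n (Suc h)"
  note D = root_mapsD[OF r]
  have "r \<in> root_maps (Suc n) h"
    using D by (intro root_mapsI) (auto intro: le_SucI)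
  then show "r \<in> {r \<in> root_maps (Suc n) h. r (Suc n) \<noteq> Suc n}"
    using D(3)[of "Suc n"] by auto
qed

text \<open>All \<open>h + 1\<close> points from \<open>Suc n\<close> on belong to blocks begun
  earlier, so the factor at \<open>Suc n\<close> has index \<open>Suc h\<close>; the remaining
  factors are literally the same.\<close>

lemma root_weight_Suc_not_root:
  assumes r: "r \<in> root_maps n (Suc h)"
  shows "root_weight \<kappa> c (Suc n) r = c (Suc h) * root_weight \<kappa> c n r"
proof -
  note D = root_mapsD[OF r]
  have "{y. Suc n \<le> y \<and> 1 \<le> r y \<and> r y < Suc n} = {Suc n..Suc n + h}"
  proof (intro set_eqI)
    fix y
    show "y \<in> {y. Suc n \<le> y \<and> 1 \<le> r y \<and> r y < Suc n} \<longleftrightarrow> y \<in> {Suc n..Suc n + h}"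
      using D(1,3,5)[of y] by (cases "n + Suc h < y") auto
  qed
  moreover have "r (Suc n) \<noteq> Suc n" using D(3)[of "Suc n"] by auto
  ultimately show ?thesis by (simp add: root_weight_def)
qed

text \<open>An interval block crosses nothing: no foreign point lies between its elements, and every
  point after it has a root at most \<open>n\<close>.\<close>

lemma insert_block_in_root_maps:
  assumes r: "r \<in> root_maps n (h - i)" and i: "i \<le> h"
  shows "insert_block n i r \<in> root_maps (Suc n) h"
proof (rule root_mapsI)
  note D = root_mapsD[OF r]
  fix y assume y: "1 \<le> y" "y \<le> Suc n + h"
  \<comment> \<open>All values of \<open>r\<close> lie at or below \<open>n\<close>, where insertion
    changes nothing, so old roots stay fixed points.\<close>
  have "insert_block n i r (r z) = r z" for z
    using D(3,4)[of z] by (simp add: insert_block_def)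
  moreover have "r (y - Suc i) \<le> y" using D(2)[of "y - Suc i"] by simp
  moreover have "r (y - Suc i) \<ge> 1" if "y > Suc (n + i)"
    using D(1)[of "y - Suc i"] that y i by simp
  ultimately show "1 \<le> insert_block n i r y \<and> insert_block n i r y \<le> y \<and> insert_block n i r y \<le> Suc n
      \<and> insert_block n i r (insert_block n i r y) = insert_block n i r y"
    using D(1-3)[of y] D(3)[of "y - Suc i"] y i
    by (auto simp: insert_block_def[of n i r y] le_Suc_eq) (auto simp: insert_block_def)
next
  fix y assume "y = 0 \<or> Suc n + h < y"
  then show "insert_block n i r y = 0"
    using root_mapsD(5)[OF r, of y] root_mapsD(5)[OF r, of "y - Suc i"] i
    by (auto simp: insert_block_def)
next
  note D = root_mapsD[OF r]
  fix x y assume a: "insert_block n i r y < x" "x < y" "y \<le> Suc n + h"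
  consider "y \<le> n" | "n < y" "y \<le> n + i + 1" | "y > n + i + 1" by linarith
  then show "insert_block n i r y \<le> insert_block n i r x"
  proof cases
    case 1
    then show ?thesis using a D(6)[of y x] by (auto simp: insert_block_def)
  next
    case 2
    then show ?thesis using a by (auto simp: insert_block_def)
  next
    case 3
    have le: "r (y - Suc i) \<le> n" by (rule D)
    consider "x \<le> n" | "n < x" "x \<le> n + i + 1" | "x > n + i + 1" by linarith
    then show ?thesis
    proof cases
      case 1
      then show ?thesis using a D(6)[of "y - Suc i" x] 3 i by (auto simp: insert_block_def)
    next
      case 2
      then show ?thesis using le 3 by (auto simp: insert_block_def)
    next
      case x: 3
      then have "r (y - Suc i) \<le> r (x - Suc i)"
        using a 3 i le by (intro D(6)) auto
      then show ?thesis using x 3 by (auto simp: insert_block_def)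
    qed
  qed
qed

lemma insert_block_fiber:
  assumes "r \<in> root_maps n h"
  shows "{y. insert_block n i r y = Suc n} = {Suc n..Suc n + i}"
proof -
  have "r y \<noteq> Suc n" for y using root_mapsD(3)[OF assms, of y] by auto
  then show ?thesis by (auto simp: insert_block_def not_le)
qed

lemma delete_insert_block: "delete_block n i (insert_block n i r) = r"
  by (auto simp: delete_block_def insert_block_def)

text \<open>The points of the new block have root \<open>Suc n\<close>, so no fiber or height
  belonging to a position up to \<open>n\<close> counts them; the only new factor is the one at
  \<open>Suc n\<close>.\<close>

lemma root_weight_insert_block:
  assumes r: "r \<in> root_maps n h"
  shows "root_weight \<kappa> c (Suc n) (insert_block n i r) = \<kappa> (Suc i) * root_weight \<kappa> c n r"
proof -
  \<comment> \<open>The increasing injection of old positions into new ones that skips the inserted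
    interval.\<close>
  define \<sigma> where "\<sigma> y = (if y \<le> n then y else y + Suc i)" for y
  have inj: "inj \<sigma>" by (rule injI) (auto simp: \<sigma>_def split: if_splits)
  \<comment> \<open>\<open>P\<close> is a condition on the root. It is used once for "equals
    \<open>x\<close>" and once for "between 1 and \<open>x - 1\<close>"; both fail at
    \<open>Suc n\<close>.\<close>
  have shift: "{y. x \<le> y \<and> P (insert_block n i r y)} = \<sigma> ` {y. x \<le> y \<and> P (r y)}"
    if "\<not> P (Suc n)" "x \<le> n" for P x
  proof (intro subset_antisym subsetI)
    fix y assume "y \<in> {y. x \<le> y \<and> P (insert_block n i r y)}"
    then have "y = \<sigma> (if y \<le> n then y else y - Suc i)"
      and "(if y \<le> n then y else y - Suc i) \<in> {y. x \<le> y \<and> P (r y)}"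
      using that by (auto simp: \<sigma>_def insert_block_def split: if_splits)
    then show "y \<in> \<sigma> ` {y. x \<le> y \<and> P (r y)}" by blast
  next
    fix y assume "y \<in> \<sigma> ` {y. x \<le> y \<and> P (r y)}"
    then show "y \<in> {y. x \<le> y \<and> P (insert_block n i r y)}"
      by (auto simp: \<sigma>_def insert_block_def)
  qed
  have fiber: "card {y. insert_block n i r y = x} = card {y. r y = x}" if "x \<le> n" for x
    using shift[of "\<lambda>v. v = x" 0] that card_image[OF inj_on_subset[OF inj]] by simp
  have height: "card {y. x \<le> y \<and> 1 \<le> insert_block n i r y \<and> insert_block n i r y < x}
      = card {y. x \<le> y \<and> 1 \<le> r y \<and> r y < x}" if "x \<le> n" for x
    using shift[of "\<lambda>v. 1 \<le> v \<and> v < x" x] that card_image[OF inj_on_subset[OF inj]] by simp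
  have "root_weight \<kappa> c n (insert_block n i r) = root_weight \<kappa> c n r"
    unfolding root_weight_def
  proof (intro prod.cong refl)
    fix x assume "x \<in> {1..n}"
    then have x: "x \<le> n" and eq: "insert_block n i r x = r x" by (auto simp: insert_block_def)
    show "(if insert_block n i r x = x then \<kappa> (card {y. insert_block n i r y = x})
        else c (card {y. x \<le> y \<and> 1 \<le> insert_block n i r y \<and> insert_block n i r y < x}))
      = (if r x = x then \<kappa> (card {y. r y = x}) else c (card {y. x \<le> y \<and> 1 \<le> r y \<and> r y < x}))"
      by (simp only: eq fiber[OF x] height[OF x])
  qed
  moreover have "insert_block n i r (Suc n) = Suc n" by (simp add: insert_block_def)
  ultimately show ?thesis
    using insert_block_fiber[OF r, of i] by (simp add: root_weight_def)
qed

text \<open>A point between \<open>Suc n\<close> and the largest element of its block has root at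
  least \<open>Suc n\<close> by non-crossing, while no root exceeds \<open>Suc n\<close>.\<close>

lemma root_fiber_interval:
  assumes r: "r \<in> root_maps (Suc n) h" and root: "r (Suc n) = Suc n"
  obtains i where "i \<le> h" "{y. r y = Suc n} = {Suc n..Suc n + i}"
proof -
  note D = root_mapsD[OF r]
  let ?K = "{y. r y = Suc n}"
  have sub: "?K \<subseteq> {Suc n..Suc n + h}"
  proof
    fix y assume "y \<in> ?K"
    then show "y \<in> {Suc n..Suc n + h}" using D(2,5)[of y] by (cases "Suc n + h < y") auto
  qed
  then have fin: "finite ?K" by (rule finite_subset) simp
  define M where "M = Max ?K"
  have M: "M \<in> ?K" using Max_in[OF fin] root unfolding M_def by blast
  then have Mb: "Suc n \<le> M" "M \<le> Suc n + h" using sub by auto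
  have "?K = {Suc n..Suc n + (M - Suc n)}"
  proof (intro subset_antisym subsetI)
    fix y assume "y \<in> ?K"
    then show "y \<in> {Suc n..Suc n + (M - Suc n)}"
      using sub Max_ge[OF fin, of y] Mb unfolding M_def by auto
  next
    fix y assume "y \<in> {Suc n..Suc n + (M - Suc n)}"
    then have y: "Suc n \<le> y" "y \<le> M" using Mb by auto
    show "y \<in> ?K"
    proof (cases "y = Suc n \<or> y = M")
      case True
      then show ?thesis using root M by auto
    next
      case False
      then have "r M \<le> r y" using M y Mb by (intro D(6)) auto
      then show ?thesis using M D(3)[of y] by auto
    qed
  qed
  moreover have "M - Suc n \<le> h" using Mb by simp
  ultimately show ?thesis using that by blast
qed

lemma insert_delete_block:
  assumes "{y. r y = Suc n} = {Suc n..Suc n + i}"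
  shows "insert_block n i (delete_block n i r) = r"
proof
  fix y
  have "r y = Suc n" if "n < y" "y \<le> n + i + 1"
    using set_eq_iff[THEN iffD1, OF assms] that by simp
  then show "insert_block n i (delete_block n i r) y = r y"
    by (auto simp: insert_block_def delete_block_def)
qed

lemma delete_block_in_root_maps:
  assumes r: "r \<in> root_maps (Suc n) h" and i: "i \<le> h"
    and K: "{y. r y = Suc n} = {Suc n..Suc n + i}"
  shows "delete_block n i r \<in> root_maps n (h - i)"
proof (rule root_mapsI)
  note D = root_mapsD[OF r]
  have K': "r y = Suc n \<longleftrightarrow> Suc n \<le> y \<and> y \<le> Suc n + i" for y
    using set_eq_iff[THEN iffD1, OF K] by simp
  \<comment> \<open>Off the deleted interval the root is not \<open>Suc n\<close>, so deletion
    removes no root that is still in use.\<close>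
  have le: "r y \<le> n" if "y \<le> n \<or> Suc n + i < y" for y
    using D(3)[of y] K'[of y] that by auto
  {
    fix y assume y: "1 \<le> y" "y \<le> n + (h - i)"
    show "1 \<le> delete_block n i r y \<and> delete_block n i r y \<le> y \<and> delete_block n i r y \<le> n
      \<and> delete_block n i r (delete_block n i r y) = delete_block n i r y"
    proof (cases "y \<le> n")
      case True
      then show ?thesis using D(1,2,4)[of y] le[of y] y by (auto simp: delete_block_def)
    next
      case False
      then show ?thesis
        using D(1,2,4)[of "y + Suc i"] le[of "y + Suc i"] y i by (auto simp: delete_block_def)
    qed
  next
    fix y assume "y = 0 \<or> n + (h - i) < y"
    then show "delete_block n i r y = 0"
      using D(5)[of y] D(5)[of "y + Suc i"] i by (auto simp: delete_block_def)
  next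
    fix x y assume a: "delete_block n i r y < x" "x < y" "y \<le> n + (h - i)"
    show "delete_block n i r y \<le> delete_block n i r x"
      \<comment> \<open>The three instances cover both points before the deleted interval, only
        \<open>y\<close> after it, and both after it.\<close>
      using a i D(6)[of y x] D(6)[of "y + Suc i" x] D(6)[of "y + Suc i" "x + Suc i"]
      by (auto simp: delete_block_def split: if_splits)
  }
qed

lemma sum_root_weight_Suc:
  fixes \<kappa> c :: "nat \<Rightarrow> real"
  defines "F \<equiv> \<lambda>n h. \<Sum>r\<in>root_maps n h. root_weight \<kappa> c n r"
  shows "F (Suc n) h = c (Suc h) * F n (Suc h) + (\<Sum>i=0..h. \<kappa> (Suc i) * F n (h - i))"
proof -
  let ?w = "root_weight \<kappa> c"
  let ?A = "{r \<in> root_maps (Suc n) h. r (Suc n) \<noteq> Suc n}"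
  let ?B = "{r \<in> root_maps (Suc n) h. r (Suc n) = Suc n}"
  have split: "root_maps (Suc n) h = ?A \<union> ?B" by auto
  have "F (Suc n) h = sum (?w (Suc n)) ?A + sum (?w (Suc n)) ?B"
    unfolding F_def by (subst split, rule sum.union_disjoint) auto
  moreover have "sum (?w (Suc n)) ?A = c (Suc h) * F n (Suc h)"
    unfolding root_maps_Suc_not_root F_def sum_distrib_left
    by (rule sum.cong) (auto simp: root_weight_Suc_not_root)
  moreover have "(\<Sum>(i, r)\<in>(SIGMA i:{0..h}. root_maps n (h - i)). \<kappa> (Suc i) * ?w n r) = sum (?w (Suc n)) ?B"
  \<comment> \<open>The block of \<open>Suc n\<close> has \<open>i + 1\<close> elements, so its
    cardinality minus 1 recovers \<open>i\<close>; deleting the block then recovers the smaller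
    map.\<close>
  proof (rule sum.reindex_bij_witness[where
        i = "\<lambda>r. let i = card {y. r y = Suc n} - 1 in (i, delete_block n i r)"
        and j = "\<lambda>(i, r). insert_block n i r"])
    fix p assume "p \<in> (SIGMA i:{0..h}. root_maps n (h - i))"
    then obtain i r where p: "p = (i, r)" and i: "i \<le> h" and r: "r \<in> root_maps n (h - i)" by auto
    show "(let i = card {y. (case p of (i, r) \<Rightarrow> insert_block n i r) y = Suc n} - 1
        in (i, delete_block n i (case p of (i, r) \<Rightarrow> insert_block n i r))) = p"
      by (simp add: p insert_block_fiber[OF r] delete_insert_block)
    show "(case p of (i, r) \<Rightarrow> insert_block n i r) \<in> ?B"
      using insert_block_in_root_maps[OF r i] by (simp add: p) (simp add: insert_block_def)
    show "?w (Suc n) (case p of (i, r) \<Rightarrow> insert_block n i r) = (case p of (i, r) \<Rightarrow> \<kappa> (Suc i) * ?w n r)"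
      by (simp add: p root_weight_insert_block[OF r])
  next
    fix r assume "r \<in> ?B"
    then have r: "r \<in> root_maps (Suc n) h" and root: "r (Suc n) = Suc n" by auto
    obtain i where i: "i \<le> h" and K: "{y. r y = Suc n} = {Suc n..Suc n + i}"
      using root_fiber_interval[OF r root] .
    have c: "card {y. r y = Suc n} - 1 = i" by (simp add: K)
    show "(case let i = card {y. r y = Suc n} - 1 in (i, delete_block n i r) of
        (i, r) \<Rightarrow> insert_block n i r) = r"
      by (simp only: Let_def c prod.case insert_delete_block[OF K])
    show "(let i = card {y. r y = Suc n} - 1 in (i, delete_block n i r))
        \<in> (SIGMA i:{0..h}. root_maps n (h - i))"
      using delete_block_in_root_maps[OF r i K] i by (simp add: Let_def c del: One_nat_def)
  qed
  moreover have "(\<Sum>(i, r)\<in>(SIGMA i:{0..h}. root_maps n (h - i)). \<kappa> (Suc i) * ?w n r)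
      = (\<Sum>i=0..h. \<kappa> (Suc i) * F n (h - i))"
    by (simp add: sum.Sigma[symmetric] F_def sum_distrib_left)
  ultimately show ?thesis by simp
qed

section \<open>Coefficients of the iterated operator\<close>

lemma T_op_nth:
  "fps_nth (T_op q \<gamma> (gen_series \<kappa>) f) h =
     C_seq q \<gamma> (Suc h) * fps_nth f (Suc h) + (\<Sum>i=0..h. \<kappa> (Suc i) * fps_nth f (h - i))"
proof -
  have "fps_nth (gen_series \<kappa> * f) h = (\<Sum>i=0..h. \<kappa> (Suc i) * fps_nth f (h - i))"
    by (simp add: fps_mult_nth gen_series_def)
  then show ?thesis
    by (simp add: T_op_def op_d_def op_d'_def C_seq_def algebra_simps)
qed

text \<open>Both sides obey the same recursion in \<open>n\<close> and agree at
  \<open>n = 0\<close>, where only the empty map with \<open>h = 0\<close> contributes.\<close>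

lemma T_op_power_nth:
  "fps_nth ((T_op q \<gamma> (gen_series \<kappa>) ^^ n) 1) h =
     (\<Sum>r\<in>root_maps n h. root_weight \<kappa> (C_seq q \<gamma>) n r)"
proof (induction n arbitrary: h)
  case 0
  then show ?case by (simp add: root_maps_0_left root_weight_def)
next
  case (Suc n)
  then show ?case by (simp add: T_op_nth sum_root_weight_Suc)
qed

text \<open>The lowering operators kill constants. This lets the iteration start from 1 instead of
  \<open>g\<close>, at the cost of one more application.\<close>

lemma T_op_one: "T_op q \<gamma> g 1 = g"
proof -
  have "op_d 1 = 0" "op_d' 1 = 0"
    using op_d_monomial[of 0] op_d'_monomial[of 0] by simp_all
  then show ?thesis by (simp add: T_op_def)
qed

lemma T_kappa_m_eq_sum_root_maps:
  assumes "k \<ge> 1"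
  shows "T_kappa_m q \<gamma> \<kappa> k = (\<Sum>r\<in>root_maps (2 * k) 0. root_weight \<kappa> (C_seq q \<gamma>) (2 * k) r)"
proof -
  let ?T = "T_op q \<gamma> (gen_series \<kappa>)"
  \<comment> \<open>Here \<open>k \<ge> 1\<close> keeps the subtraction on naturals from
    truncating.\<close>
  have "(?T ^^ (2 * k)) 1 = (?T ^^ (2 * k - 1)) (?T 1)"
    using assms by (metis One_nat_def Suc_pred comp_apply funpow_Suc_right mult_pos_pos pos2
        less_eq_Suc_le)
  then show ?thesis
    by (simp only: T_kappa_m_def T_op_power_nth[symmetric] T_op_one)
qed

section \<open>Translation between set partitions and root maps\<close>

text \<open>The value 0 outside all blocks agrees with the default value in
  \<open>root_maps\<close>.\<close>

definition block_root :: "nat set set \<Rightarrow> nat \<Rightarrow> nat" where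
  "block_root \<pi> y = (if y \<in> \<Union>\<pi> then Min (THE B. B \<in> \<pi> \<and> y \<in> B) else 0)"

text \<open>The condition \<open>1 \<le> x\<close> discards the fiber over 0, which collects the
  points outside the partitioned interval.\<close>

definition root_fibers :: "(nat \<Rightarrow> nat) \<Rightarrow> nat set set" where
  "root_fibers r = (\<lambda>x. {y. r y = x}) ` {x. 1 \<le> x \<and> r x = x}"

lemma block_root_eq:
  assumes "partition_on A \<pi>" "B \<in> \<pi>" "y \<in> B"
  shows "block_root \<pi> y = Min B"
proof -
  have "(THE B. B \<in> \<pi> \<and> y \<in> B) = B"
    using assms partition_onD2[OF assms(1)] by (intro the_equality) (auto dest: disjointD)
  then show ?thesis using assms by (auto simp: block_root_def)
qed

lemma partition_on_interval_block:
  fixes \<pi> :: "nat set set"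
  assumes "partition_on {1..n} \<pi>" "B \<in> \<pi>"
  shows "finite B" "B \<noteq> {}" "B \<subseteq> {1..n}" "Min B \<in> B" "Max B \<in> B"
proof -
  show "B \<subseteq> {1..n}" using assms partition_onD1 by blast
  then show "finite B" by (rule finite_subset) simp
  show "B \<noteq> {}" using assms partition_onD3 by blast
  with \<open>finite B\<close> show "Min B \<in> B" "Max B \<in> B" by auto
qed

lemma block_root_fiber:
  assumes p: "partition_on {1..n} \<pi>" and B: "B \<in> \<pi>"
  shows "{y. block_root \<pi> y = Min B} = B"
proof (intro subset_antisym subsetI)
  note PB = partition_on_interval_block[OF p]
  fix y assume "y \<in> {y. block_root \<pi> y = Min B}"
  then have y: "block_root \<pi> y = Min B" by simp
  \<comment> \<open>Blocks consist of positive numbers, so a minimum is never confused with the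
    default value 0.\<close>
  have "Min B \<noteq> 0" using PB(3,4)[OF B] by fastforce
  then have "y \<in> \<Union>\<pi>" using y by (auto simp: block_root_def split: if_splits)
  then obtain D where D: "D \<in> \<pi>" "y \<in> D" by blast
  then have "Min D = Min B" using y block_root_eq[OF p] by simp
  then have "Min B \<in> D \<inter> B" using PB(4)[OF D(1)] PB(4)[OF B] by simp
  then have "D = B" using partition_onD2[OF p] D(1) B by (auto dest: disjointD)
  then show "y \<in> B" using D by simp
qed (simp add: block_root_eq[OF p B])

lemma block_root_in_root_maps:
  assumes p: "partition_on {1..n} \<pi>" and nc: "noncrossing \<pi>"
  shows "block_root \<pi> \<in> root_maps n 0"
proof (rule root_mapsI)
  note PB = partition_on_interval_block[OF p]
  note R = block_root_eq[OF p]
  have ex: "\<exists>B\<in>\<pi>. y \<in> B" if "1 \<le> y" "y \<le> n" for y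
    using that partition_onD1[OF p] by auto
  {
    fix y assume "1 \<le> y" "y \<le> n + 0"
    then obtain B where B: "B \<in> \<pi>" "y \<in> B" using ex by auto
    have "Min B \<in> {1..n}" using PB(3,4)[OF B(1)] by blast
    moreover have "Min B \<le> y" using PB(1)[OF B(1)] B(2) by simp
    ultimately show "1 \<le> block_root \<pi> y \<and> block_root \<pi> y \<le> y \<and> block_root \<pi> y \<le> n
      \<and> block_root \<pi> (block_root \<pi> y) = block_root \<pi> y"
      using R[OF B] R[OF B(1) PB(4)[OF B(1)]] by auto
  next
    fix y assume "y = 0 \<or> n + 0 < y"
    then have "y \<notin> {1..n}" by auto
    then have "y \<notin> \<Union>\<pi>" by (simp only: partition_onD1[OF p, symmetric] not_False_eq_True)
    then show "block_root \<pi> y = 0" by (simp add: block_root_def del: Union_iff)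
  next
    fix x y assume a: "block_root \<pi> y < x" "x < y" "y \<le> n + 0"
    obtain B where B: "B \<in> \<pi>" "y \<in> B" using ex[of y] a by auto
    obtain D where D: "D \<in> \<pi>" "x \<in> D" using ex[of x] a by auto
    show "block_root \<pi> y \<le> block_root \<pi> x"
    \<comment> \<open>Otherwise \<open>Min D < Min B < x < y\<close> alternates between
      \<open>D\<close> and \<open>B\<close>, a crossing.\<close>
    proof (rule ccontr)
      assume "\<not> ?thesis"
      then have less: "Min D < Min B" using R[OF B] R[OF D] by simp
      then have "D \<noteq> B" by auto
      moreover have "Min B < x" using a R[OF B] by simp
      then have "\<exists>a\<in>D. \<exists>b\<in>B. \<exists>c\<in>D. \<exists>d\<in>B. a < b \<and> b < c \<and> c < d"
        using less a(2) B(2) D(2) PB(4)[OF B(1)] PB(4)[OF D(1)] by meson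
      ultimately have "\<exists>A\<in>\<pi>. \<exists>B\<in>\<pi>. A \<noteq> B \<and>
          (\<exists>a\<in>A. \<exists>b\<in>B. \<exists>c\<in>A. \<exists>d\<in>B. a < b \<and> b < c \<and> c < d)"
        by (intro bexI[OF _ D(1)] bexI[OF _ B(1)] conjI)
      with nc show False unfolding noncrossing_def by (rule notE)
    qed
  }
qed

lemma root_fibers_block_root:
  assumes p: "partition_on {1..n} \<pi>"
  shows "root_fibers (block_root \<pi>) = \<pi>"
proof (intro subset_antisym subsetI)
  note PB = partition_on_interval_block[OF p]
  note R = block_root_eq[OF p]
  {
    fix B assume "B \<in> root_fibers (block_root \<pi>)"
    then obtain x where x: "1 \<le> x" "block_root \<pi> x = x" and B: "B = {y. block_root \<pi> y = x}"
      by (auto simp: root_fibers_def)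
    then obtain D where D: "D \<in> \<pi>" "x \<in> D" by (auto simp: block_root_def split: if_splits)
    then have "x = Min D" using R x by simp
    then have "B = D" using B block_root_fiber[OF p D(1)] by simp
    then show "B \<in> \<pi>" using D by simp
  next
    fix B assume B: "B \<in> \<pi>"
    have "1 \<le> Min B" using PB(3,4)[OF B] by auto
    then show "B \<in> root_fibers (block_root \<pi>)"
      using R[OF B PB(4)[OF B]] block_root_fiber[OF p B] unfolding root_fibers_def by blast
  }
qed

lemma root_fibers_partition:
  assumes r: "r \<in> root_maps n 0"
  shows "partition_on {1..n} (root_fibers r)"
proof (rule partition_onI)
  note D = root_mapsD[OF r]
  have pos: "1 \<le> y \<and> y \<le> n" if "1 \<le> r y" for y
    using D(5)[of y] that by (cases "y = 0 \<or> n + 0 < y") auto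
  show "\<Union> (root_fibers r) = {1..n}"
  proof (intro subset_antisym subsetI)
    fix y assume "y \<in> {1..n}"
    then have "1 \<le> r y" using D(1) by simp
    then have "{z. r z = r y} \<in> root_fibers r"
      unfolding root_fibers_def using D(4)[of y] by blast
    then show "y \<in> \<Union> (root_fibers r)" by blast
  qed (use pos in \<open>auto simp: root_fibers_def\<close>)
  show "disjnt p q" if "p \<in> root_fibers r" "q \<in> root_fibers r" "p \<noteq> q" for p q
    using that by (auto simp: root_fibers_def disjnt_def)
  show "{} \<notin> root_fibers r"
    by (auto simp: root_fibers_def)
qed

lemma Min_root_fiber:
  assumes r: "r \<in> root_maps n h" and x: "1 \<le> x" "r x = x"
  shows "Min {y. r y = x} = x"
proof (rule Min_eqI)
  note D = root_mapsD[OF r]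
  have "{y. r y = x} \<subseteq> {0..n + h}"
  proof
    fix y assume "y \<in> {y. r y = x}"
    then show "y \<in> {0..n + h}" using D(5)[of y] x by (cases "n + h < y") auto
  qed
  then show "finite {y. r y = x}" by (rule finite_subset) simp
  show "\<And>y. y \<in> {y. r y = x} \<Longrightarrow> x \<le> y" using D(2) by auto
  show "x \<in> {y. r y = x}" using x by simp
qed

text \<open>For a crossing \<open>a < b < c < d\<close>, the point \<open>c\<close> lies between
  \<open>r d\<close> and \<open>d\<close>, and \<open>b\<close> lies between \<open>r c\<close> and
  \<open>c\<close>. The two resulting inequalities force the two roots to coincide.\<close>

lemma root_fibers_noncrossing:
  assumes r: "r \<in> root_maps n 0"
  shows "noncrossing (root_fibers r)"
  unfolding noncrossing_def
proof (intro notI, elim bexE exE conjE)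
  note D = root_mapsD[OF r]
  fix A B a b c d
  assume A: "A \<in> root_fibers r" and B: "B \<in> root_fibers r" and ne: "A \<noteq> B"
    and in_A: "a \<in> A" "c \<in> A" and in_B: "b \<in> B" "d \<in> B" and ord: "a < b" "b < c" "c < d"
  have "r a = r c" "r b = r d" "r a \<noteq> r b" "1 \<le> r a" "1 \<le> r b"
    using A B ne in_A in_B by (auto simp: root_fibers_def)
  moreover have "r a \<le> a" "r b \<le> b" by (rule D)+
  moreover have "d \<le> n" "c \<le> n" using D(5)[of d] D(5)[of c] calculation by force+
  moreover have "r d \<le> r c"
    using ord calculation by (intro D(6)) auto
  moreover have "r c \<le> r b"
    using ord calculation by (intro D(6)) auto
  ultimately show False by simp
qed

lemma block_root_root_fibers:
  assumes r: "r \<in> root_maps n 0"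
  shows "block_root (root_fibers r) = r"
proof
  fix y
  note D = root_mapsD[OF r]
  note p = root_fibers_partition[OF r]
  show "block_root (root_fibers r) y = r y"
  proof (cases "y \<in> {1..n}")
    case True
    then have pos: "1 \<le> r y" using D(1) by simp
    then have "{z. r z = r y} \<in> root_fibers r"
      unfolding root_fibers_def using D(4)[of y] by blast
    then have "block_root (root_fibers r) y = Min {z. r z = r y}"
      by (intro block_root_eq[OF p]) auto
    then show ?thesis using Min_root_fiber[OF r pos D(4)] by simp
  next
    case False
    then have "y = 0 \<or> n + 0 < y" by auto
    then have "r y = 0" by (rule D(5))
    moreover have "y \<notin> \<Union> (root_fibers r)" using False by (simp only: partition_onD1[OF p, symmetric] not_False_eq_True)
    ultimately show ?thesis by (simp add: block_root_def del: Union_iff)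
  qed
qed

section \<open>Block weights from root weights\<close>

text \<open>As \<open>x\<close> descends through \<open>A\<close>, the number of elements at or
  above it runs through 1, 2, ..., \<open>card A\<close>. Inductively, a new minimum leaves the
  earlier counts alone and receives the largest one.\<close>

lemma prod_card_tail:
  fixes A :: "'a::linorder set" and f :: "nat \<Rightarrow> 'b::comm_monoid_mult"
  assumes "finite A"
  shows "(\<Prod>x\<in>A. f (m + card {y \<in> A. x \<le> y})) = prod f {m + 1..m + card A}"
  using assms
proof (induction A rule: finite_linorder_min_induct)
  case empty
  then show ?case by simp
next
  case (insert b A)
  have "b \<notin> A" using insert by auto
  have "{y \<in> insert b A. x \<le> y} = {y \<in> A. x \<le> y}" if "x \<in> A" for x
    using insert that by auto
  then have "(\<Prod>x\<in>A. f (m + card {y \<in> insert b A. x \<le> y})) = prod f {m + 1..m + card A}"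
    using insert.IH by simp
  moreover have "{y \<in> insert b A. b \<le> y} = insert b A" using insert by force
  moreover have "prod f {m + 1..Suc (m + card A)} = prod f {m + 1..m + card A} * f (Suc (m + card A))"
    by (subst prod.nat_ivl_Suc') (auto simp: mult.commute)
  ultimately show ?case
    using insert \<open>b \<notin> A\<close> by (simp add: mult.commute)
qed

text \<open>The point of this splitting is that its first part does not depend on \<open>x\<close>,
  so the height of \<open>x\<close> is a constant of the block plus the rank of \<open>x\<close>
  from the top of \<open>B\<close>.\<close>

lemma block_root_height:
  assumes p: "partition_on {1..n} \<pi>" and nc: "noncrossing \<pi>"
    and B: "B \<in> \<pi>" and x: "x \<in> B" "x \<noteq> Min B"
  shows "{y. x \<le> y \<and> 1 \<le> block_root \<pi> y \<and> block_root \<pi> y < x}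
    = {y. Max B < y \<and> 1 \<le> block_root \<pi> y \<and> block_root \<pi> y \<le> Min B} \<union> {y \<in> B - {Min B}. x \<le> y}"
    (is "?L = ?R")
proof -
  let ?r = "block_root \<pi>"
  note PB = partition_on_interval_block[OF p B]
  note D = root_mapsD[OF block_root_in_root_maps[OF p nc]]
  have rB: "?r z = Min B" if "z \<in> B" for z using block_root_eq[OF p B that] .
  have MB: "Min B < x" using x PB by (metis Min_le le_neq_implies_less)
  have pos: "1 \<le> Min B" using PB(3,4) by auto
  have Max_le: "Max B \<le> n" using subsetD[OF PB(3,5)] by simp
  show ?thesis
  proof (intro subset_antisym subsetI)
    fix y assume "y \<in> ?L"
    then have y: "x \<le> y" "1 \<le> ?r y" "?r y < x" by auto
    have yn: "y \<le> n" using D(5)[of y] y by force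
    \<comment> \<open>If \<open>y\<close> is not \<open>x\<close>, then \<open>x\<close> lies
      strictly between the root of \<open>y\<close> and \<open>y\<close>, so non-crossing bounds
      that root by the root of \<open>x\<close>.\<close>
    have le: "?r y \<le> Min B"
    proof (cases "y = x")
      case False
      then show ?thesis using D(6)[of y x] y yn rB[OF x(1)] by simp
    qed (use rB x in simp)
    show "y \<in> ?R"
    \<comment> \<open>A point between \<open>Min B\<close> and \<open>Max B\<close> has root at
      least \<open>Min B\<close> by non-crossing. Together with the upper bound this puts
      \<open>y\<close> in \<open>B\<close>.\<close>
    proof (cases "Max B < y")
      case False
      have "y \<in> B"
      proof (cases "y = Max B")
        case ne: False
        then have "?r (Max B) \<le> ?r y"
          using D(6)[of "Max B" y] False rB[OF PB(5)] MB y Max_le by simp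
        then have "?r y = Min B" using le rB[OF PB(5)] by simp
        then show ?thesis using block_root_fiber[OF p B] by blast
      qed (use PB in simp)
      then show ?thesis using y MB by auto
    qed (use y le in auto)
  next
    fix y assume "y \<in> ?R"
    then show "y \<in> ?L"
      using rB[of y] MB pos Max_ge[OF PB(1) x(1)] by auto
  qed
qed

text \<open>By the height splitting the indices are \<open>Q\<close> plus the ranks 1, 2, ... of the
  non-minimal elements of \<open>B\<close>. They end at \<open>P\<close> because the points counted
  by \<open>P\<close> but not by \<open>Q\<close> are exactly these elements.\<close>

lemma prod_block_root_height:
  assumes p: "partition_on {1..n} \<pi>" and nc: "noncrossing \<pi>" and B: "B \<in> \<pi>"
  defines "r \<equiv> block_root \<pi>"
  defines "Q \<equiv> card {y. Max B < y \<and> 1 \<le> r y \<and> r y \<le> Min B}"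
    and "P \<equiv> card {y. Min B < y \<and> 1 \<le> r y \<and> r y \<le> Min B}"
  shows "(\<Prod>x\<in>B - {Min B}. c (card {y. x \<le> y \<and> 1 \<le> r y \<and> r y < x})) = prod c {Q + 1..P}"
proof -
  note PB = partition_on_interval_block[OF p B]
  note D = root_mapsD[OF block_root_in_root_maps[OF p nc]]
  let ?U = "{y. Max B < y \<and> 1 \<le> r y \<and> r y \<le> Min B}"
  have rB: "r z = Min B" if "z \<in> B" for z using block_root_eq[OF p B that] by (simp add: r_def)
  have pos: "1 \<le> Min B" using PB(3,4) by auto
  have Max_le: "Max B \<le> n" using subsetD[OF PB(3,5)] by simp
  have "?U \<subseteq> {0..n}"
  proof
    fix y assume "y \<in> ?U"
    then show "y \<in> {0..n}" using D(5)[of y] by (cases "n < y") (auto simp: r_def)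
  qed
  then have finU: "finite ?U" by (rule finite_subset) simp
  have disj: "?U \<inter> T = {}" if "T \<subseteq> B" for T
    using that Max_ge[OF PB(1)] by fastforce
  have height: "card {y. x \<le> y \<and> 1 \<le> r y \<and> r y < x} = Q + card {y \<in> B - {Min B}. x \<le> y}"
    if "x \<in> B - {Min B}" for x
    using that block_root_height[OF p nc B, of x] finU PB(1) disj
    unfolding Q_def r_def by (subst card_Un_disjoint[symmetric]) auto
  have "{y. Min B < y \<and> 1 \<le> r y \<and> r y \<le> Min B} = ?U \<union> (B - {Min B})"
  proof (intro subset_antisym subsetI)
    fix y assume "y \<in> {y. Min B < y \<and> 1 \<le> r y \<and> r y \<le> Min B}"
    then have y: "Min B < y" "1 \<le> r y" "r y \<le> Min B" by auto
    have "y \<in> B" if "\<not> Max B < y"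
    proof (cases "y = Max B")
      case False
      then have "r (Max B) \<le> r y"
        using D(6)[of "Max B" y, folded r_def] that rB[OF PB(5)] y Max_le by simp
      then have "r y = Min B" using y rB[OF PB(5)] by simp
      then show ?thesis using block_root_fiber[OF p B] unfolding r_def by blast
    qed (use PB in simp)
    then show "y \<in> ?U \<union> (B - {Min B})" using y by auto
  next
    fix y assume "y \<in> ?U \<union> (B - {Min B})"
    moreover have "Min B \<le> Max B" using PB by simp
    moreover have "Min B < y" if "y \<in> B" "y \<noteq> Min B"
      using that PB by (metis Min_le le_neq_implies_less)
    ultimately show "y \<in> {y. Min B < y \<and> 1 \<le> r y \<and> r y \<le> Min B}"
      using rB[of y] pos by auto
  qed
  then have P: "P = Q + card (B - {Min B})"
    unfolding P_def Q_def using finU PB(1) disj by (simp add: card_Un_disjoint)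
  have "(\<Prod>x\<in>B - {Min B}. c (card {y. x \<le> y \<and> 1 \<le> r y \<and> r y < x}))
      = (\<Prod>x\<in>B - {Min B}. c (Q + card {y \<in> B - {Min B}. x \<le> y}))"
    using height by (intro prod.cong) auto
  also have "\<dots> = prod c {Q + 1..P}"
    unfolding P by (rule prod_card_tail) (use PB in simp)
  finally show ?thesis .
qed

text \<open>Blocks are listed by increasing minimum, so a point lies in one of the first blocks
  exactly when its root does not exceed the minimum of the last of them. This turns
  \<open>P_stat\<close> and \<open>Q_stat\<close> into conditions on roots.\<close>

lemma first_blocks_eq:
  assumes \<pi>: "\<pi> \<in> NC_even n" and i: "i < length (blocks \<pi>)"
  shows "first_blocks \<pi> i = {y. 1 \<le> block_root \<pi> y \<and> block_root \<pi> y \<le> Min (blocks \<pi> ! i)}"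
proof -
  have p: "partition_on {1..n} \<pi>" using \<pi> by (simp add: NC_even_def)
  note PB = partition_on_interval_block[OF p]
  note bl = blocks_NC_even[OF \<pi>]
  have mem: "blocks \<pi> ! j \<in> \<pi>" if "j \<le> i" for j
    using bl(1) i that by (metis nth_mem le_less_trans)
  show ?thesis
  proof (intro subset_antisym subsetI)
    fix y assume "y \<in> first_blocks \<pi> i"
    then obtain j where j: "j \<le> i" "y \<in> blocks \<pi> ! j" by (auto simp: first_blocks_def)
    have "Min (blocks \<pi> ! j) \<le> Min (blocks \<pi> ! i)"
      using sorted_wrt_nth_less[OF bl(2), of j i] i j by (cases "j = i") auto
    moreover have "1 \<le> Min (blocks \<pi> ! j)" using PB(3,4)[OF mem[OF j(1)]] by auto
    ultimately show "y \<in> {y. 1 \<le> block_root \<pi> y \<and> block_root \<pi> y \<le> Min (blocks \<pi> ! i)}"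
      using block_root_eq[OF p mem[OF j(1)] j(2)] by simp
  next
    fix y assume "y \<in> {y. 1 \<le> block_root \<pi> y \<and> block_root \<pi> y \<le> Min (blocks \<pi> ! i)}"
    then have y: "1 \<le> block_root \<pi> y" "block_root \<pi> y \<le> Min (blocks \<pi> ! i)" by auto
    then obtain B where B: "B \<in> \<pi>" "y \<in> B" by (auto simp: block_root_def split: if_splits)
    then obtain j where j: "j < length (blocks \<pi>)" "B = blocks \<pi> ! j"
      using bl(1) by (metis in_set_conv_nth)
    have "\<not> i < j"
      using sorted_wrt_nth_less[OF bl(2), of i j] j y block_root_eq[OF p B] by auto
    then show "y \<in> first_blocks \<pi> i" using j B by (auto simp: first_blocks_def)
  qed
qed

lemma root_weight_block_root:
  assumes \<pi>: "\<pi> \<in> NC_even n"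
  shows "root_weight \<kappa> (C_seq q \<gamma>) n (block_root \<pi>) = W_weight q \<gamma> \<pi> * (\<Prod>B\<in>\<pi>. \<kappa> (card B))"
proof -
  have p: "partition_on {1..n} \<pi>" and nc: "noncrossing \<pi>" using \<pi> by (auto simp: NC_even_def)
  note PB = partition_on_interval_block[OF p]
  note bl = blocks_NC_even[OF \<pi>]
  let ?r = "block_root \<pi>" and ?c = "C_seq q \<gamma>"
  let ?t = "\<lambda>x. if ?r x = x then \<kappa> (card {y. ?r y = x}) else ?c (card {y. x \<le> y \<and> 1 \<le> ?r y \<and> ?r y < x})"
  let ?h = "\<lambda>B. prod ?c {card {y. Max B < y \<and> 1 \<le> ?r y \<and> ?r y \<le> Min B} + 1
      ..card {y. Min B < y \<and> 1 \<le> ?r y \<and> ?r y \<le> Min B}}"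
  \<comment> \<open>In a block only the minimum is a fixed point; it supplies the cumulant, and the
    other elements supply the weight.\<close>
  have block: "prod ?t B = \<kappa> (card B) * ?h B" if B: "B \<in> \<pi>" for B
  proof -
    have rB: "?r z = Min B" if "z \<in> B" for z using block_root_eq[OF p B that] .
    have "prod ?t B = ?t (Min B) * prod ?t (B - {Min B})"
      using PB[OF B] by (intro prod.remove) auto
    also have "?t (Min B) = \<kappa> (card B)"
      using rB[OF PB(4)[OF B]] block_root_fiber[OF p B] by simp
    also have "prod ?t (B - {Min B}) = (\<Prod>x\<in>B - {Min B}. ?c (card {y. x \<le> y \<and> 1 \<le> ?r y \<and> ?r y < x}))"
      using rB by (intro prod.cong) auto
    finally show ?thesis by (simp only: prod_block_root_height[OF p nc B])
  qed
  have "root_weight \<kappa> ?c n ?r = prod ?t (\<Union>\<pi>)"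
    using partition_onD1[OF p] by (simp add: root_weight_def)
  also have "\<dots> = (\<Prod>B\<in>\<pi>. prod ?t B)"
    using PB(1) partition_onD2[OF p] by (subst prod.Union_disjoint) (auto dest: disjointD)
  also have "\<dots> = (\<Prod>B\<in>\<pi>. ?h B) * (\<Prod>B\<in>\<pi>. \<kappa> (card B))"
    by (simp add: block prod.distrib mult.commute)
  also have "(\<Prod>B\<in>\<pi>. ?h B) = (\<Prod>i<length (blocks \<pi>). ?h (blocks \<pi> ! i))"
  proof (rule prod.reindex_bij_betw[symmetric])
    \<comment> \<open>Strictly increasing minima rule out repetitions, so list positions enumerate
      the blocks bijectively.\<close>
    have "distinct (blocks \<pi>)"
      using bl(2) by (auto simp: distinct_conv_nth sorted_wrt_iff_nth_less)
        (metis linorder_neqE_nat nat_less_le)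
    then show "bij_betw ((!) (blocks \<pi>)) {..<length (blocks \<pi>)} \<pi>"
      using bl(1) by (metis bij_betw_nth)
  qed
  also have "\<dots> = W_weight q \<gamma> \<pi>"
    unfolding W_weight_def P_stat_def Q_stat_def
    by (intro prod.cong refl) (simp add: first_blocks_eq[OF \<pi>] conj_ac)
  finally show ?thesis .
qed

section \<open>Restriction to even blocks and the final sum\<close>

theorem theorem5p5:
  fixes q \<gamma> :: real and \<kappa> m :: "nat \<Rightarrow> real"
  assumes "q \<ge> 1" and "\<gamma> > 0"
    and "\<And>l. l \<ge> 1 \<Longrightarrow> odd l \<Longrightarrow> \<kappa> l = 0"
    and "\<And>k. k \<ge> 1 \<Longrightarrow> odd k \<Longrightarrow> m k = 0"
    and "\<And>k. k \<ge> 1 \<Longrightarrow> m (2 * k) = T_kappa_m q \<gamma> \<kappa> k"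
  shows "\<forall>k\<ge>1. m (2 * k) =
    (\<Sum>\<pi>\<in>NC_even (2 * k). W_weight q \<gamma> \<pi> * (\<Prod>B\<in>\<pi>. \<kappa> (card B)))"
proof (intro allI impI)
  fix k :: nat assume k: "k \<ge> 1"
  let ?n = "2 * k" and ?w = "root_weight \<kappa> (C_seq q \<gamma>) (2 * k)"
  let ?E = "{r \<in> root_maps ?n 0. \<forall>B\<in>root_fibers r. even (card B)}"
  \<comment> \<open>A map outside \<open>?E\<close> has a block of odd size, whose root contributes
    a vanishing cumulant.\<close>
  have "?w r = 0" if r_in: "r \<in> root_maps ?n 0 - ?E" for r
  proof -
    have r: "r \<in> root_maps ?n 0" using r_in by simp
    obtain B where "B \<in> root_fibers r" "odd (card B)"
      using r_in by blast
    then obtain x where x: "1 \<le> x" "r x = x" and odd: "odd (card {y. r y = x})"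
      unfolding root_fibers_def by blast
    have mem: "x \<in> {1..?n}" using x root_mapsD(3)[OF r, of x] by simp
    have zero: "\<kappa> (card {y. r y = x}) = 0"
      \<comment> \<open>An odd cardinality is positive, as required because nothing is assumed about
        \<open>\<kappa> 0\<close>.\<close>
      by (rule assms(3)[OF _ odd]) (simp only: One_nat_def Suc_le_eq odd_pos[OF odd])
    show ?thesis unfolding root_weight_def
      by (intro prod_zero bexI[OF _ mem] finite_atLeastAtMost) (simp add: x(2) zero)
  qed
  then have "(\<Sum>r\<in>root_maps ?n 0. ?w r) = (\<Sum>r\<in>?E. ?w r)"
    by (intro sum.mono_neutral_right) auto
  also have "\<dots> = (\<Sum>\<pi>\<in>NC_even ?n. W_weight q \<gamma> \<pi> * (\<Prod>B\<in>\<pi>. \<kappa> (card B)))"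
  \<comment> \<open>Taking fibers and taking minima are mutually inverse, and block sizes are read
    off the fibers, so evenness carries over in both directions.\<close>
  proof (rule sum.reindex_bij_witness[where i = block_root and j = root_fibers])
    fix r assume "r \<in> ?E"
    then have r: "r \<in> root_maps ?n 0" and even: "\<forall>B\<in>root_fibers r. even (card B)" by auto
    show eq: "block_root (root_fibers r) = r" by (rule block_root_root_fibers[OF r])
    show mem: "root_fibers r \<in> NC_even ?n"
      using root_fibers_partition[OF r] root_fibers_noncrossing[OF r] even by (simp add: NC_even_def)
    show "W_weight q \<gamma> (root_fibers r) * (\<Prod>B\<in>root_fibers r. \<kappa> (card B)) = ?w r"
      using root_weight_block_root[OF mem, of \<kappa> q \<gamma>] eq by simp
  next
    fix \<pi> assume "\<pi> \<in> NC_even ?n"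
    then have p: "partition_on {1..?n} \<pi>" and nc: "noncrossing \<pi>" and even: "\<forall>B\<in>\<pi>. even (card B)"
      by (auto simp: NC_even_def)
    show eq: "root_fibers (block_root \<pi>) = \<pi>" by (rule root_fibers_block_root[OF p])
    show "block_root \<pi> \<in> ?E" using block_root_in_root_maps[OF p nc] even eq by simp
  qed
  finally show "m ?n = (\<Sum>\<pi>\<in>NC_even ?n. W_weight q \<gamma> \<pi> * (\<Prod>B\<in>\<pi>. \<kappa> (card B)))"
    using assms(5)[OF k] T_kappa_m_eq_sum_root_maps[OF k] by simp
qed

end
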